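(* Let $n\ge 1$, let $S$ be a subring of $\mathbb{R}$ that is finitely generated as a $\mathbb{Z}$-module, let $K$ be the field of fractions of $S$ in $\mathbb{R}$, and let $\varGamma\subset\mathbb{R}^n$ be an $S$-module over $K$ in $\mathbb{R}^n$. Then every non-zero vector of $\varGamma$ defines a coincidence reflection of $\varGamma$ (that is, $\rho_\gamma\in\operatorname{OC}(\varGamma)$ for every $\gamma\in\varGamma\setminus\{0\}$), and every coincidence isometry of $\varGamma$ can be decomposed into a product of at most $n$ reflections defined by non-zero elements of $\varGamma$.
   Context: Subrings of $\mathbb{R}$ contain $1$. $\mathbb{R}^n$ carries the standard inner product $\langle\cdot,\cdot\rangle$, and $\operatorname{O}(n)$ is its group of linear isometries. A subset $\varGamma\subset\mathbb{R}^n$ is called an $S$-module over $K$ in $\mathbb{R}^n$ if $\varGamma$ is a free $S$-module of rank $n$ that spans $\mathbb{R}^n$ over $\mathbb{R}$ (i.e. $\varGamma$ is the $S$-span of an $\mathbb{R}$-basis of $\mathbb{R}^n$) and $\langle\gamma,\gamma\rangle\in K$ for all $\gamma\in\varGamma$. Two additive subgroups $\varGamma,\varGamma'$ of $\mathbb{R}^n$ are commensurate, written $\varGamma\sim\varGamma'$, if $\varGamma\cap\varGamma'$ has finite subgroup index in both $\varGamma$ and $\varGamma'$. A coincidence isometry of $\varGamma$ is an $f\in\operatorname{O}(n)$ with $\varGamma\sim f(\varGamma)$; $\operatorname{OC}(\varGamma)$ is the set of all of these. For $0\neq\gamma\in\mathbb{R}^n$, the reflection defined by $\gamma$ is $\rho_\gamma(x)=x-2\frac{\langle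 x,\gamma\rangle}{\langle\gamma,\gamma\rangle}\gamma$. A coincidence reflection of $\varGamma$ is a reflection belonging to $\operatorname{OC}(\varGamma)$. The empty product of reflections is the identity. *)

theory Defs
  imports "HOL-Analysis.Analysis"
begin

definition real_subring :: "real set \<Rightarrow> bool" where
  "real_subring S \<longleftrightarrow>
     1 \<in> S \<and> (\<forall>x\<in>S. \<forall>y\<in>S. x - y \<in> S) \<and> (\<forall>x\<in>S. \<forall>y\<in>S. x * y \<in> S)"

(* The linear combinations of elements of B with coefficients in R; used for finite B only.
   For R a subring of the reals this is the R-module generated by B. *)
definition span_over :: "real set \<Rightarrow> 'a::real_vector set \<Rightarrow> 'a set" where
  "span_over R B = {(\<Sum>b\<in>B. c b *\<^sub>R b) | c. \<forall>b\<in>B. c b \<in> R}"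

definition fin_gen_Z_module :: "'a::real_vector set \<Rightarrow> bool" where
  "fin_gen_Z_module M \<longleftrightarrow> (\<exists>B. finite B \<and> M = span_over \<int> B)"

definition fraction_field_in_real :: "real set \<Rightarrow> real set" where
  "fraction_field_in_real S = {a / b | a b. a \<in> S \<and> b \<in> S \<and> b \<noteq> 0}"

(* The S-span of a real basis of the ambient space, with all squared norms in K.
   A basis of real ^ 'n is automatically finite, with CARD('n) elements. *)
definition S_module_over :: "real set \<Rightarrow> real set \<Rightarrow> (real ^ 'n) set \<Rightarrow> bool" where
  "S_module_over S K \<Gamma> \<longleftrightarrow>
     (\<exists>B. independent B \<and> span B = UNIV \<and> \<Gamma> = span_over S B) \<and>
     (\<forall>\<gamma>\<in>\<Gamma>. \<gamma> \<bullet> \<gamma> \<in> K)"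

(* Finitely many cosets g + H with g in G; intended for additive subgroups H of G. *)
definition finite_index_in :: "'a::ab_group_add set \<Rightarrow> 'a set \<Rightarrow> bool" where
  "finite_index_in H G \<longleftrightarrow> finite ((\<lambda>g. (+) g ` H) ` G)"

definition commensurate :: "'a::ab_group_add set \<Rightarrow> 'a set \<Rightarrow> bool" where
  "commensurate G G' \<longleftrightarrow> finite_index_in (G \<inter> G') G \<and> finite_index_in (G \<inter> G') G'"

definition OC :: "(real ^ 'n) set \<Rightarrow> (real ^ 'n \<Rightarrow> real ^ 'n) set" where
  "OC \<Gamma> = {f. orthogonal_transformation f \<and> commensurate \<Gamma> (f ` \<Gamma>)}"

(* The reflection defined by \<gamma>, meaningful for \<gamma> \<noteq> 0. *)
definition reflection :: "real ^ 'n \<Rightarrow> real ^ 'n \<Rightarrow> real ^ 'n" where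
  "reflection \<gamma> x = x - (2 * ((x \<bullet> \<gamma>) / (\<gamma> \<bullet> \<gamma>))) *\<^sub>R \<gamma>"

end

theory Submission
  imports Defs
begin

text \<open>Everything is expressed through the \<^emph>\<open>rational hull\<close> of an additive subgroup
  \<open>H\<close>, the set of vectors having a positive integer multiple in \<open>H\<close>, that is, the copy of
  the tensor product of \<open>H\<close> with the rationals inside the ambient space.

  The rational hull of \<open>S\<close> is a field: multiplication by a non-zero \<open>s \<in> S\<close> is injective on
  this finite-dimensional rational vector space, hence surjective, so \<open>1 / s\<close> lies in it
  (\<open>inverse_in_rational_hull\<close>). Thus it contains \<open>K\<close>, which means that every
  denominator occurring in \<open>K\<close> may be taken to be a positive integer. By polarization
  \<open>2 \<langle>v, \<gamma>\<rangle>\<close> and \<open>\<langle>\<gamma>, \<gamma>\<rangle>\<close> belong to this field for all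
  \<open>v, \<gamma> \<in> \<Gamma>\<close>, so the reflection
  along \<open>\<gamma>\<close> maps \<open>\<Gamma>\<close> into the rational hull of \<open>\<Gamma>\<close>
  (\<open>reflection_in_rational_hull\<close>).

  Finite index is tied to the rational hull in both directions. A finite index subgroup contains a
  multiple of each element by the pigeonhole principle
  (\<open>finite_index_imp_subset_rational_hull\<close>); conversely, if \<open>H\<close> contains a positive multiple of each
  of finitely many generators, then only finitely many cosets are left
  (\<open>finite_index_inI\<close>). Since \<open>S\<close>, and with it \<open>\<Gamma>\<close>, is finitely generated over the
  integers, and a reflection is its own inverse, the first assertion follows.

  For the second assertion, a coincidence isometry \<open>f\<close> maps \<open>\<Gamma>\<close> into its rational hull. The
  argument of Cartan and Dieudonne then works inside that hull: if \<open>f\<close> moves the basis vector \<open>b\<close>,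
  the reflection along \<open>f b - b\<close> sends \<open>f b\<close> to \<open>b\<close> and fixes every vector fixed by \<open>f\<close>, so
  composing with it lowers the number of moved basis vectors (\<open>reflection_decomposition\<close>).
  A positive multiple of \<open>f b - b\<close> lies in \<open>\<Gamma>\<close> and defines the same reflection.\<close>

section \<open>Additive subgroups and their rational hulls\<close>

definition add_subgroup :: "'a::ab_group_add set \<Rightarrow> bool" where
  "add_subgroup H \<longleftrightarrow> 0 \<in> H \<and> (\<forall>x\<in>H. \<forall>y\<in>H. x - y \<in> H)"

definition rational_hull :: "'a::real_vector set \<Rightarrow> 'a set" where
  "rational_hull H = {v. \<exists>N>0. real N *\<^sub>R v \<in> H}"

lemma rational_hullI: "N > 0 \<Longrightarrow> real N *\<^sub>R v \<in> H \<Longrightarrow> v \<in> rational_hull H"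
  unfolding rational_hull_def by blast

lemma rational_hullE:
  assumes "v \<in> rational_hull H"
  obtains N where "N > 0" "real N *\<^sub>R v \<in> H"
  using assms unfolding rational_hull_def by blast

lemma subset_rational_hull: "H \<subseteq> rational_hull H"
  by (auto intro: rational_hullI[of 1])

lemma add_subgroup_diff: "add_subgroup H \<Longrightarrow> x \<in> H \<Longrightarrow> y \<in> H \<Longrightarrow> x - y \<in> H"
  unfolding add_subgroup_def by blast

lemma add_subgroup_uminus:
  assumes "add_subgroup H" "x \<in> H" shows "- x \<in> H"
proof -
  have "0 - x \<in> H" using assms unfolding add_subgroup_def by blast
  thus ?thesis by simp
qed

lemma add_subgroup_add:
  assumes "add_subgroup H" "x \<in> H" "y \<in> H" shows "x + y \<in> H"
  using add_subgroup_diff[OF assms(1,2) add_subgroup_uminus[OF assms(1,3)]] by simp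

lemma add_subgroup_sum:
  assumes "add_subgroup H" "\<And>i. i \<in> I \<Longrightarrow> f i \<in> H" shows "sum f I \<in> H"
  using assms(2)
proof (induction I rule: infinite_finite_induct)
  case (insert i I)
  then show ?case by (simp add: add_subgroup_add[OF assms(1)])
qed (use assms(1) in \<open>auto simp: add_subgroup_def\<close>)

lemma add_subgroup_scaleR_nat:
  fixes x :: "'a::real_vector"
  assumes "add_subgroup H" "x \<in> H" shows "real n *\<^sub>R x \<in> H"
proof (induction n)
  case 0
  show ?case using assms(1) by (simp add: add_subgroup_def)
next
  case (Suc n)
  then show ?case using add_subgroup_add[OF assms(1,2)] by (simp add: scaleR_add_left)
qed

lemma add_subgroup_scaleR_int:
  fixes x :: "'a::real_vector"
  assumes "add_subgroup H" "x \<in> H" shows "of_int k *\<^sub>R x \<in> H"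
proof (cases k)
  case (nonneg n)
  then show ?thesis using add_subgroup_scaleR_nat[OF assms] by simp
next
  case (neg n)
  have "of_int k *\<^sub>R x = - (real (Suc n) *\<^sub>R x)"
    unfolding neg by (metis of_int_minus of_int_of_nat_eq scaleR_minus_left)
  then show ?thesis
    using add_subgroup_uminus[OF assms(1) add_subgroup_scaleR_nat[OF assms]] by metis
qed

lemma add_subgroup_rational_hull:
  assumes H: "add_subgroup H" shows "add_subgroup (rational_hull H)"
  unfolding add_subgroup_def
proof (intro conjI ballI)
  show "0 \<in> rational_hull H" using H subset_rational_hull unfolding add_subgroup_def by blast
next
  fix x y assume "x \<in> rational_hull H" "y \<in> rational_hull H"
  then obtain M N where MN: "M > 0" "real M *\<^sub>R x \<in> H" "N > 0" "real N *\<^sub>R y \<in> H"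
    by (metis rational_hullE)
  have "real N *\<^sub>R (real M *\<^sub>R x) - real M *\<^sub>R (real N *\<^sub>R y) \<in> H"
    using add_subgroup_diff[OF H] add_subgroup_scaleR_nat[OF H] MN by blast
  hence "real (M * N) *\<^sub>R (x - y) \<in> H" by (simp add: algebra_simps)
  thus "x - y \<in> rational_hull H" using MN(1,3) by (auto intro: rational_hullI[of "M * N"])
qed

lemma rational_hull_idem: "rational_hull (rational_hull H) \<subseteq> rational_hull H"
proof
  fix x assume "x \<in> rational_hull (rational_hull H)"
  then obtain M N where "M > 0" "N > 0" "real N *\<^sub>R (real M *\<^sub>R x) \<in> H"
    by (metis rational_hullE)
  thus "x \<in> rational_hull H" by (intro rational_hullI[of "N * M"]) auto
qed

text \<open>Maps with this property can be composed: the condition need only be tested on \<open>H\<close>, but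
  then passes to the whole hull.\<close>

lemma linear_image_rational_hull:
  assumes f: "linear f" and im: "f ` H \<subseteq> rational_hull H'"
  shows "f ` rational_hull H \<subseteq> rational_hull H'"
proof
  fix y assume "y \<in> f ` rational_hull H"
  then obtain x N where x: "y = f x" "N > 0" "real N *\<^sub>R x \<in> H" by (auto elim: rational_hullE)
  have "real N *\<^sub>R y \<in> rational_hull H'" using x im f by (auto simp: linear_cmul[symmetric])
  thus "y \<in> rational_hull H'" using x(2) rational_hull_idem rational_hullI by blast
qed

lemma add_subgroup_linear_image:
  assumes "linear f" "add_subgroup H" shows "add_subgroup (f ` H)"
  using assms unfolding add_subgroup_def
  by (auto simp: linear_diff[symmetric] linear_0 intro: image_eqI[of 0 f 0])

lemma add_subgroup_Int: "add_subgroup G \<Longrightarrow> add_subgroup H \<Longrightarrow> add_subgroup (G \<inter> H)"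
  by (auto simp: add_subgroup_def)

section \<open>Finite index\<close>

lemma coset_eqI:
  assumes H: "add_subgroup H" and "g - g' \<in> H" shows "(+) g ` H = (+) g' ` H"
proof -
  have sub: "(+) a ` H \<subseteq> (+) b ` H" if "a - b \<in> H" for a b
  proof
    fix x assume "x \<in> (+) a ` H"
    then obtain h where h: "h \<in> H" "x = a + h" by auto
    have "x = b + ((a - b) + h)" using h by simp
    thus "x \<in> (+) b ` H" using add_subgroup_add[OF H that h(1)] by blast
  qed
  have "g' - g \<in> H" using add_subgroup_uminus[OF assms] by simp
  thus ?thesis using sub assms(2) by blast
qed

text \<open>Among the cosets of the multiples \<open>0, g, 2 g, \<dots>\<close> two must coincide; the difference of
  the two multiples is a positive multiple of \<open>g\<close> that lies in \<open>H\<close>.\<close>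

lemma finite_index_imp_subset_rational_hull:
  fixes G :: "'a::real_vector set"
  assumes fin: "finite_index_in H G" and G: "add_subgroup G" and H: "add_subgroup H"
  shows "G \<subseteq> rational_hull H"
proof
  fix g assume g: "g \<in> G"
  let ?c = "\<lambda>n::nat. (+) (real n *\<^sub>R g) ` H"
  have "range ?c \<subseteq> (\<lambda>g. (+) g ` H) ` G" using add_subgroup_scaleR_nat[OF G g] by blast
  hence "finite (range ?c)" using fin finite_subset unfolding finite_index_in_def by blast
  hence "\<not> inj ?c" using finite_imageD infinite_UNIV_nat by blast
  then obtain i j where ij: "i < j" "?c i = ?c j"
    using linorder_injI[of ?c] by blast
  have "0 \<in> H" using H unfolding add_subgroup_def by blast
  hence "real j *\<^sub>R g \<in> ?c j" by force
  then obtain h where h: "h \<in> H" "real j *\<^sub>R g = real i *\<^sub>R g + h" unfolding ij(2)[symmetric] by auto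
  have "real (j - i) *\<^sub>R g = h" using h(2) ij(1) by (simp add: of_nat_diff algebra_simps)
  thus "g \<in> rational_hull H" using h(1) ij(1) by (auto intro: rational_hullI[of "j - i"])
qed

text \<open>If \<open>N i\<close> times the \<open>i\<close>-th generator lies in \<open>H\<close>, the coset of an integer combination of the
  generators depends only on the residues of the coefficients modulo \<open>N i\<close>.\<close>

lemma finite_index_inI:
  fixes G :: "'a::real_vector set"
  assumes H: "add_subgroup H" and I: "finite I"
    and e: "\<And>i. i \<in> I \<Longrightarrow> e i \<in> rational_hull H"
    and G: "\<And>g. g \<in> G \<Longrightarrow> \<exists>c. g = (\<Sum>i\<in>I. of_int (c i) *\<^sub>R e i)"
  shows "finite_index_in H G"
proof -
  have "\<forall>i\<in>I. \<exists>N>0. real N *\<^sub>R e i \<in> H" using e unfolding rational_hull_def by blast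
  from bchoice[OF this] obtain N :: "_ \<Rightarrow> nat"
    where N: "\<forall>i\<in>I. N i > 0 \<and> real (N i) *\<^sub>R e i \<in> H" by blast
  let ?v = "\<lambda>c::_ \<Rightarrow> int. \<Sum>i\<in>I. of_int (c i) *\<^sub>R e i"
  have "(\<lambda>g. (+) g ` H) ` G \<subseteq> (\<lambda>c. (+) (?v c) ` H) ` PiE I (\<lambda>i. {0..<int (N i)})"
  proof
    fix X assume "X \<in> (\<lambda>g. (+) g ` H) ` G"
    then obtain c where X: "X = (+) (?v c) ` H" using G by auto
    define d where "d = (\<lambda>i\<in>I. c i mod int (N i))"
    have "?v c - ?v d = (\<Sum>i\<in>I. of_int (c i div int (N i)) *\<^sub>R (real (N i) *\<^sub>R e i))"
      unfolding sum_subtractf[symmetric]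
    proof (rule sum.cong[OF refl])
      fix i assume i: "i \<in> I"
      have d: "d i = c i mod int (N i)" using i by (simp add: d_def)
      have "c i = c i div int (N i) * int (N i) + d i" unfolding d by simp
      hence "real_of_int (c i) = of_int (c i div int (N i) * int (N i) + d i)" by (rule arg_cong)
      also have "\<dots> = of_int (c i div int (N i)) * real (N i) + of_int (d i)"
        by (simp only: of_int_add of_int_mult of_int_of_nat_eq)
      finally have eq: "real_of_int (c i) = of_int (c i div int (N i)) * real (N i) + of_int (d i)" .
      show "of_int (c i) *\<^sub>R e i - of_int (d i) *\<^sub>R e i
          = of_int (c i div int (N i)) *\<^sub>R (real (N i) *\<^sub>R e i)"
        by (subst eq) (simp only: scaleR_add_left scaleR_scaleR add_diff_cancel_right')
    qed
    also have "\<dots> \<in> H"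
      using N by (auto intro!: add_subgroup_sum[OF H] add_subgroup_scaleR_int[OF H] simp del: scaleR_scaleR)
    finally have "X = (+) (?v d) ` H" unfolding X by (rule coset_eqI[OF H])
    moreover have "d \<in> PiE I (\<lambda>i. {0..<int (N i)})" using N by (auto simp: d_def)
    ultimately show "X \<in> (\<lambda>c. (+) (?v c) ` H) ` PiE I (\<lambda>i. {0..<int (N i)})" by blast
  qed
  moreover have "finite (PiE I (\<lambda>i. {0..<int (N i)}))" using I by (intro finite_PiE) auto
  ultimately show ?thesis unfolding finite_index_in_def
    by (rule finite_subset[OF _ finite_imageI])
qed

section \<open>Modules over subrings of the reals\<close>

lemma real_subring_add_subgroup: "real_subring S \<Longrightarrow> add_subgroup S"
  unfolding real_subring_def add_subgroup_def by (metis diff_self)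

lemma span_over_superset:
  assumes "0 \<in> R" "1 \<in> R" "finite B" shows "B \<subseteq> span_over R B"
proof
  fix b assume b: "b \<in> B"
  have "(\<Sum>x\<in>B. (if x = b then 1 else 0) *\<^sub>R x) = (\<Sum>x\<in>B. if x = b then x else 0)"
    by (rule sum.cong) auto
  hence "b = (\<Sum>x\<in>B. (if x = b then 1 else 0) *\<^sub>R x)" using b assms(3) by simp
  thus "b \<in> span_over R B" unfolding span_over_def using assms(1,2)
    by (intro CollectI exI[of _ "\<lambda>x. if x = b then 1 else 0"]) auto
qed

lemma fin_gen_Z_moduleE:
  assumes "fin_gen_Z_module M"
  obtains C where "finite C" "C \<subseteq> M"
    "\<And>x. x \<in> M \<Longrightarrow> \<exists>c. x = (\<Sum>b\<in>C. of_int (c b) *\<^sub>R b)"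
proof -
  obtain C where C: "finite C" "M = span_over \<int> C" using assms unfolding fin_gen_Z_module_def by blast
  have "C \<subseteq> M" unfolding C(2) by (rule span_over_superset[OF Ints_0 Ints_1 C(1)])
  moreover have "\<exists>c. x = (\<Sum>b\<in>C. of_int (c b) *\<^sub>R b)" if x: "x \<in> M" for x
  proof -
    obtain c where c: "x = (\<Sum>b\<in>C. c b *\<^sub>R b)" "\<forall>b\<in>C. c b \<in> \<int>"
      using x unfolding C(2) span_over_def by blast
    have "x = (\<Sum>b\<in>C. of_int \<lfloor>c b\<rfloor> *\<^sub>R b)" unfolding c(1) using c(2) by (intro sum.cong) auto
    thus ?thesis by (intro exI[of _ "\<lambda>b. \<lfloor>c b\<rfloor>"])
  qed
  ultimately show thesis using that C(1) by blast
qed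

lemma span_over_add_subgroup:
  assumes "real_subring S" shows "add_subgroup (span_over S B)"
  unfolding add_subgroup_def
proof (intro conjI ballI)
  have "0 \<in> S" using real_subring_add_subgroup[OF assms] by (simp add: add_subgroup_def)
  thus "0 \<in> span_over S B" unfolding span_over_def by (intro CollectI exI[of _ "\<lambda>_. 0"]) auto
next
  fix x y assume "x \<in> span_over S B" "y \<in> span_over S B"
  then obtain c d where "x = (\<Sum>b\<in>B. c b *\<^sub>R b)" "y = (\<Sum>b\<in>B. d b *\<^sub>R b)"
      "\<forall>b\<in>B. c b \<in> S" "\<forall>b\<in>B. d b \<in> S"
    unfolding span_over_def by blast
  thus "x - y \<in> span_over S B" unfolding span_over_def using assms
    by (intro CollectI exI[of _ "\<lambda>b. c b - d b"])
      (auto simp: sum_subtractf scaleR_diff_left real_subring_def)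
qed

lemma span_over_scaleR:
  assumes "real_subring S" "s \<in> S" "v \<in> span_over S B" shows "s *\<^sub>R v \<in> span_over S B"
proof -
  obtain c where "v = (\<Sum>b\<in>B. c b *\<^sub>R b)" "\<forall>b\<in>B. c b \<in> S"
    using assms(3) unfolding span_over_def by blast
  thus ?thesis unfolding span_over_def using assms(1,2)
    by (intro CollectI exI[of _ "\<lambda>b. s * c b"]) (auto simp: scaleR_sum_right real_subring_def)
qed

text \<open>Generators of the coefficient ring times generators of the module generate the module over
  the integers. They are indexed by pairs because different pairs may give the same vector.\<close>

lemma span_over_generators:
  assumes C: "\<And>x. x \<in> S \<Longrightarrow> \<exists>c. x = (\<Sum>a\<in>C. of_int (c a) *\<^sub>R a)"
    and v: "v \<in> span_over S B"
  shows "\<exists>c. v = (\<Sum>(b, a)\<in>B \<times> C. of_int (c (b, a)) *\<^sub>R (a *\<^sub>R b))"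
proof -
  obtain c where c: "v = (\<Sum>b\<in>B. c b *\<^sub>R b)" "\<forall>b\<in>B. c b \<in> S"
    using v unfolding span_over_def by blast
  have "\<forall>b\<in>B. \<exists>d. c b = (\<Sum>a\<in>C. of_int (d a) *\<^sub>R a)" using C c(2) by blast
  from bchoice[OF this] obtain d
    where d: "\<forall>b\<in>B. c b = (\<Sum>a\<in>C. of_int (d b a) *\<^sub>R a)" by blast
  have "v = (\<Sum>b\<in>B. \<Sum>a\<in>C. of_int (d b a) *\<^sub>R (a *\<^sub>R b))"
    unfolding c(1) by (rule sum.cong[OF refl]) (simp add: d scaleR_sum_left)
  hence "v = (\<Sum>(b, a)\<in>B \<times> C. of_int (case_prod d (b, a)) *\<^sub>R (a *\<^sub>R b))"
    by (simp add: sum.cartesian_product)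
  thus ?thesis by blast
qed

section \<open>The field of fractions of a finitely generated ring\<close>

interpretation rat_real: vector_space "\<lambda>(q::rat) (x::real). of_rat q * x"
  by unfold_locales (auto simp: algebra_simps of_rat_add of_rat_mult)

text \<open>The rational hull of \<open>S\<close> is the rational span of finitely many generators, and multiplication by
  \<open>s\<close> maps it injectively to itself. In finite dimension the map is then onto, and a preimage of \<open>1\<close>
  is the inverse of \<open>s\<close>. Surjectivity at \<open>1\<close> is obtained by counting: were \<open>1\<close> outside the image,
  adjoining it to the image of a basis would give an independent set larger than the basis.\<close>

lemma inverse_in_rational_hull:
  assumes S: "real_subring S" and fg: "fin_gen_Z_module S" and s: "s \<in> S" "s \<noteq> 0"
  shows "inverse s \<in> rational_hull S"
proof -
  note H = add_subgroup_rational_hull[OF real_subring_add_subgroup[OF S]]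
  interpret mult: Vector_Spaces.linear "\<lambda>(q::rat) (x::real). of_rat q * x"
    "\<lambda>(q::rat) (x::real). of_rat q * x" "(*) s"
    by unfold_locales (auto simp: algebra_simps)
  interpret pair: vector_space_pair "\<lambda>(q::rat) (x::real). of_rat q * x"
    "\<lambda>(q::rat) (x::real). of_rat q * x" ..
  obtain C where C: "finite C" "C \<subseteq> S" "\<And>x. x \<in> S \<Longrightarrow> \<exists>c. x = (\<Sum>b\<in>C. of_int (c b) *\<^sub>R b)"
    using fin_gen_Z_moduleE[OF fg] by blast
  have S_span: "S \<subseteq> rat_real.span C"
  proof
    fix x assume "x \<in> S"
    then obtain c :: "real \<Rightarrow> int" where c: "x = (\<Sum>b\<in>C. of_rat (of_int (c b)) * b)"
      using C(3)[of x] by (auto simp: scaleR_conv_of_real)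
    show "x \<in> rat_real.span C" unfolding c
      by (intro rat_real.span_sum rat_real.span_scale rat_real.span_base)
  qed
  have sub: "rat_real.subspace (rational_hull S)"
  proof (rule rat_real.subspaceI)
    show "0 \<in> rational_hull S" using H unfolding add_subgroup_def by blast
    show "x + y \<in> rational_hull S" if "x \<in> rational_hull S" "y \<in> rational_hull S" for x y
      using add_subgroup_add[OF H that] .
    fix q :: rat and x assume x: "x \<in> rational_hull S"
    obtain a b where q: "q = of_int a / of_int b" "b > 0"
      by (metis Fract_of_int_quotient quotient_of_denom_pos' quotient_of_div prod.collapse)
    have "real (nat b) *\<^sub>R (of_rat q * x) = of_int a *\<^sub>R x"
      using q by (simp add: of_rat_divide)
    hence "real (nat b) *\<^sub>R (of_rat q * x) \<in> rational_hull S"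
      using add_subgroup_scaleR_int[OF H x] by metis
    thus "of_rat q * x \<in> rational_hull S"
      using rational_hullI[of "nat b"] rational_hull_idem q(2) zero_less_nat_eq by (meson subsetD)
  qed
  have span_hull: "rat_real.span C \<subseteq> rational_hull S"
    using rat_real.span_minimal[OF _ sub] C(2) subset_rational_hull by blast
  obtain A where A: "A \<subseteq> C" "rat_real.independent A" "C \<subseteq> rat_real.span A"
    using rat_real.maximal_independent_subset by blast
  have finA: "finite A" using A(1) C(1) finite_subset by blast
  have spanA: "rat_real.span A = rat_real.span C"
    using A(1,3) by (metis rat_real.span_eq rat_real.span_superset order_trans)
  have inj: "inj_on ((*) s) X" for X using s(2) by (auto simp: inj_on_def)
  have indep: "rat_real.independent ((*) s ` A)"
    using mult.linear_axioms A(2) inj pair.linear_independent_injective_image by blast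
  have in_span: "(*) s ` A \<subseteq> rat_real.span A"
    using A(1) C(2) s(1) S S_span unfolding spanA real_subring_def by blast
  have one: "1 \<in> rat_real.span A" using S S_span spanA unfolding real_subring_def by blast
  have "1 \<in> rat_real.span ((*) s ` A)"
  proof (rule ccontr)
    assume out: "1 \<notin> rat_real.span ((*) s ` A)"
    have "rat_real.independent (insert 1 ((*) s ` A))"
      using rat_real.independent_insertI[OF out indep] .
    moreover have "insert 1 ((*) s ` A) \<subseteq> rat_real.span A" using one in_span by blast
    ultimately have "card (insert 1 ((*) s ` A)) \<le> card A"
      using rat_real.independent_span_bound[OF finA] by blast
    moreover have "1 \<notin> (*) s ` A" using out rat_real.span_base by blast
    ultimately show False using finA card_image[OF inj, of A] by simp
  qed
  then obtain y where y: "y \<in> rat_real.span A" "1 = s * y"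
    unfolding mult.span_image by blast
  have "inverse s = y" using y(2) by (metis inverse_unique)
  thus ?thesis using y(1) spanA span_hull by auto
qed

lemma rational_hull_mult:
  assumes "\<And>s v. s \<in> S \<Longrightarrow> v \<in> M \<Longrightarrow> s *\<^sub>R v \<in> M"
    and "k \<in> rational_hull S" and "v \<in> rational_hull M"
  shows "k *\<^sub>R v \<in> rational_hull M"
proof -
  obtain N where N: "N > 0" "real N *\<^sub>R k \<in> S" using assms(2) by (rule rational_hullE)
  obtain M' where M: "M' > 0" "real M' *\<^sub>R v \<in> M" using assms(3) by (rule rational_hullE)
  have "(real N *\<^sub>R k) *\<^sub>R (real M' *\<^sub>R v) \<in> M" using N M assms(1) by blast
  hence "real (N * M') *\<^sub>R (k *\<^sub>R v) \<in> M" by (simp add: algebra_simps)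
  thus ?thesis using N(1) M(1) by (auto intro: rational_hullI[of "N * M'"])
qed

lemma rational_hull_divide:
  assumes S: "real_subring S" and fg: "fin_gen_Z_module S"
    and x: "x \<in> rational_hull S" and y: "y \<in> rational_hull S"
  shows "x / y \<in> rational_hull S"
proof (cases "y = 0")
  case True
  then show ?thesis
    using add_subgroup_rational_hull[OF real_subring_add_subgroup[OF S]] by (simp add: add_subgroup_def)
next
  case False
  have mult: "a * b \<in> rational_hull S" if "a \<in> rational_hull S" "b \<in> rational_hull S" for a b
    using rational_hull_mult[of S S a b] that S unfolding real_subring_def by auto
  obtain N where N: "N > 0" "real N *\<^sub>R y \<in> S" using y by (rule rational_hullE)
  have "inverse (real N * y) \<in> rational_hull S"
    using inverse_in_rational_hull[OF S fg N(2)] N(1) False by simp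
  hence "real N *\<^sub>R inverse (real N * y) \<in> rational_hull S"
    using add_subgroup_scaleR_nat add_subgroup_rational_hull real_subring_add_subgroup[OF S] by blast
  hence "inverse y \<in> rational_hull S" using N(1) by (simp add: field_simps)
  thus ?thesis using mult[OF x] by (simp add: divide_inverse)
qed

lemma fraction_field_subset_rational_hull:
  assumes "real_subring S" "fin_gen_Z_module S"
  shows "fraction_field_in_real S \<subseteq> rational_hull S"
  using rational_hull_divide[OF assms] subset_rational_hull
  unfolding fraction_field_in_real_def by blast

section \<open>Reflections\<close>

lemma reflection_linear: "linear (reflection \<gamma>)"
  by (rule linearI) (auto simp: reflection_def inner_add_left add_divide_distrib algebra_simps)

lemma reflection_involution: "reflection \<gamma> (reflection \<gamma> x) = x"
  by (cases "\<gamma> = 0") (auto simp: reflection_def inner_diff_left algebra_simps)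

lemma reflection_orthogonal: "orthogonal_transformation (reflection \<gamma>)"
proof -
  have "reflection \<gamma> v \<bullet> reflection \<gamma> w = v \<bullet> w" for v w
    by (cases "\<gamma> = 0")
      (auto simp: reflection_def inner_diff_left inner_diff_right inner_commute field_simps)
  thus ?thesis unfolding orthogonal_transformation_def using reflection_linear by blast
qed

lemma reflection_scaleR: "r \<noteq> 0 \<Longrightarrow> reflection (r *\<^sub>R \<gamma>) = reflection \<gamma>"
  by (rule ext) (simp add: reflection_def)

lemma reflection_fixes: "x \<bullet> \<gamma> = 0 \<Longrightarrow> reflection \<gamma> x = x"
  by (simp add: reflection_def)

lemma reflection_swaps:
  assumes "norm u = norm v" shows "reflection (u - v) u = v"
proof (cases "u = v")
  case False
  have "u \<bullet> u = v \<bullet> v" using assms by (simp add: norm_eq)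
  hence "(u - v) \<bullet> (u - v) = 2 * (u \<bullet> (u - v))"
    by (simp add: inner_diff_left inner_diff_right inner_commute)
  moreover have "(u - v) \<bullet> (u - v) \<noteq> 0" using False by simp
  ultimately have "2 * ((u \<bullet> (u - v)) / ((u - v) \<bullet> (u - v))) = 1" by simp
  thus ?thesis unfolding reflection_def by (simp only: scaleR_one) simp
qed (simp add: reflection_def)

text \<open>The coefficient \<open>2 \<langle>v, \<gamma>\<rangle> / \<langle>\<gamma>, \<gamma>\<rangle>\<close> is a quotient of
  elements of the rational hull of \<open>S\<close>, since polarization expresses its numerator by squared norms
  of elements of \<open>\<Gamma>\<close>.\<close>

lemma reflection_in_rational_hull:
  assumes S: "real_subring S" and fg: "fin_gen_Z_module S"
    and G: "add_subgroup \<Gamma>" and SG: "\<And>s v. s \<in> S \<Longrightarrow> v \<in> \<Gamma> \<Longrightarrow> s *\<^sub>R v \<in> \<Gamma>"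
    and norms: "\<And>v. v \<in> \<Gamma> \<Longrightarrow> v \<bullet> v \<in> rational_hull S"
    and \<gamma>: "\<gamma> \<in> \<Gamma>" and v: "v \<in> \<Gamma>"
  shows "reflection \<gamma> v \<in> rational_hull \<Gamma>"
proof -
  note HS = add_subgroup_rational_hull[OF real_subring_add_subgroup[OF S]]
  have "2 * (v \<bullet> \<gamma>) = ((v + \<gamma>) \<bullet> (v + \<gamma>) - v \<bullet> v) - \<gamma> \<bullet> \<gamma>"
    by (simp add: inner_add_left inner_add_right inner_commute)
  also have "\<dots> \<in> rational_hull S"
    using \<gamma> v by (intro add_subgroup_diff[OF HS] norms add_subgroup_add[OF G])
  finally have "2 * (v \<bullet> \<gamma>) / (\<gamma> \<bullet> \<gamma>) \<in> rational_hull S"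
    using rational_hull_divide[OF S fg] norms[OF \<gamma>] by blast
  hence "2 * ((v \<bullet> \<gamma>) / (\<gamma> \<bullet> \<gamma>)) \<in> rational_hull S" by simp
  hence "(2 * ((v \<bullet> \<gamma>) / (\<gamma> \<bullet> \<gamma>))) *\<^sub>R \<gamma> \<in> rational_hull \<Gamma>"
    using rational_hull_mult[OF SG] \<gamma> subset_rational_hull by blast
  thus ?thesis unfolding reflection_def
    using add_subgroup_diff[OF add_subgroup_rational_hull[OF G]] v subset_rational_hull by blast
qed

section \<open>Coincidence isometries\<close>

lemma OC_imp_rational:
  assumes G: "add_subgroup \<Gamma>" and f: "f \<in> OC \<Gamma>"
  shows "f ` \<Gamma> \<subseteq> rational_hull \<Gamma>"
proof -
  have lin: "linear f" and fin: "finite_index_in (\<Gamma> \<inter> f ` \<Gamma>) (f ` \<Gamma>)"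
    using f by (auto simp: OC_def commensurate_def orthogonal_transformation_def)
  note fG = add_subgroup_linear_image[OF lin G]
  have "f ` \<Gamma> \<subseteq> rational_hull (\<Gamma> \<inter> f ` \<Gamma>)"
    using finite_index_imp_subset_rational_hull[OF fin fG add_subgroup_Int[OF G fG]] .
  thus ?thesis unfolding rational_hull_def by blast
qed

text \<open>For an involution one inclusion suffices: if \<open>N\<close> times \<open>f x\<close> is in \<open>\<Gamma>\<close>, then applying \<open>f\<close>
  shows that \<open>N\<close> times \<open>x\<close> is in \<open>f ` \<Gamma>\<close>. So the generators of both groups have multiples in
  the intersection.\<close>

lemma rational_involution_in_OC:
  assumes I: "finite I" and e: "\<And>i. i \<in> I \<Longrightarrow> e i \<in> \<Gamma>"
    and gen: "\<And>x. x \<in> \<Gamma> \<Longrightarrow> \<exists>c. x = (\<Sum>i\<in>I. of_int (c i) *\<^sub>R e i)"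
    and G: "add_subgroup \<Gamma>"
    and f: "orthogonal_transformation f" and inv: "\<And>x. f (f x) = x"
    and rat: "f ` \<Gamma> \<subseteq> rational_hull \<Gamma>"
  shows "f \<in> OC \<Gamma>"
proof -
  have lin: "linear f" using f by (simp add: orthogonal_transformation_def)
  note fG = add_subgroup_linear_image[OF lin G]
  note H = add_subgroup_Int[OF G fG]
  have hull: "e i \<in> rational_hull (\<Gamma> \<inter> f ` \<Gamma>) \<and> f (e i) \<in> rational_hull (\<Gamma> \<inter> f ` \<Gamma>)"
    if "i \<in> I" for i
  proof -
    have b: "e i \<in> \<Gamma>" using that e by blast
    then obtain N where N: "N > 0" "real N *\<^sub>R f (e i) \<in> \<Gamma>"
      using rat by (meson imageI rational_hullE subsetD)
    have Nb: "real N *\<^sub>R e i \<in> \<Gamma>" by (rule add_subgroup_scaleR_nat[OF G b])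
    have "f (real N *\<^sub>R e i) = real N *\<^sub>R f (e i)" "f (real N *\<^sub>R f (e i)) = real N *\<^sub>R e i"
      using inv by (simp_all add: linear_cmul[OF lin])
    hence "real N *\<^sub>R f (e i) \<in> f ` \<Gamma>" "real N *\<^sub>R e i \<in> f ` \<Gamma>"
      using Nb N(2) by (metis imageI)+
    thus ?thesis using N Nb by (auto intro: rational_hullI)
  qed
  have "finite_index_in (\<Gamma> \<inter> f ` \<Gamma>) \<Gamma>"
    using gen hull by (intro finite_index_inI[OF H I, of e]) auto
  moreover have "finite_index_in (\<Gamma> \<inter> f ` \<Gamma>) (f ` \<Gamma>)"
  proof (rule finite_index_inI[OF H I, of "\<lambda>i. f (e i)"])
    fix g assume "g \<in> f ` \<Gamma>"
    then obtain c where "g = f (\<Sum>i\<in>I. of_int (c i) *\<^sub>R e i)" using gen by blast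
    hence "g = (\<Sum>i\<in>I. of_int (c i) *\<^sub>R f (e i))"
      by (simp add: linear_sum[OF lin] linear_cmul[OF lin])
    thus "\<exists>c. g = (\<Sum>i\<in>I. of_int (c i) *\<^sub>R f (e i))" by blast
  qed (use hull in blast)
  ultimately show ?thesis using f unfolding OC_def commensurate_def by blast
qed

text \<open>Induction on the number of moved vectors of \<open>B\<close>. For the vector \<open>f b - b\<close> of a moved \<open>b\<close>,
  every fixed vector \<open>x\<close> of \<open>f\<close> satisfies \<open>\<langle>x, f b\<rangle> = \<langle>f x, f b\<rangle> = \<langle>x, b\<rangle>\<close>,
  so \<open>x\<close> is orthogonal to \<open>f b - b\<close> and stays fixed after composing with the reflection, while
  \<open>b\<close> becomes fixed.\<close>

lemma reflection_decomposition:
  fixes \<Gamma> B :: "(real ^ 'n) set"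
  assumes G: "add_subgroup \<Gamma>" and B: "finite B" "B \<subseteq> \<Gamma>" "span B = UNIV"
    and refl: "\<And>\<gamma>. \<gamma> \<in> \<Gamma> \<Longrightarrow> reflection \<gamma> ` \<Gamma> \<subseteq> rational_hull \<Gamma>"
    and f: "orthogonal_transformation f" "f ` \<Gamma> \<subseteq> rational_hull \<Gamma>"
  shows "\<exists>\<gamma>s. length \<gamma>s \<le> card {b\<in>B. f b \<noteq> b} \<and> set \<gamma>s \<subseteq> \<Gamma> - {0} \<and>
    f = foldr (\<circ>) (map reflection \<gamma>s) id"
  using f
proof (induction "card {b\<in>B. f b \<noteq> b}" arbitrary: f rule: less_induct)
  case less
  have lin: "linear f" and inner: "\<And>v w. f v \<bullet> f w = v \<bullet> w"
    using less.prems(1) unfolding orthogonal_transformation_def by blast+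
  show ?case
  proof (cases "\<forall>b\<in>B. f b = b")
    case True
    have "f = id"
    proof
      fix x
      show "f x = id x"
        by (rule linear_eq_on_span[OF lin linear_id, of B]) (use True B(3) in auto)
    qed
    thus ?thesis by (intro exI[of _ "[]"]) auto
  next
    case False
    then obtain b where b: "b \<in> B" "f b \<noteq> b" by blast
    have "f b \<in> rational_hull \<Gamma>" using less.prems(2) b(1) B(2) by blast
    moreover have "b \<in> rational_hull \<Gamma>" using b(1) B(2) subset_rational_hull by blast
    ultimately have "f b - b \<in> rational_hull \<Gamma>"
      by (rule add_subgroup_diff[OF add_subgroup_rational_hull[OF G]])
    then obtain N where N: "N > 0" "real N *\<^sub>R (f b - b) \<in> \<Gamma>" by (rule rational_hullE)
    \<comment> \<open>The reflecting vector must lie in \<open>\<Gamma>\<close> itself, not only in its hull;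
      rescaling does not change the reflection.\<close>
    define \<gamma> where "\<gamma> = real N *\<^sub>R (f b - b)"
    have \<gamma>: "\<gamma> \<in> \<Gamma>" "\<gamma> \<noteq> 0" using N b(2) by (auto simp: \<gamma>_def)
    have refl_eq: "reflection \<gamma> = reflection (f b - b)"
      unfolding \<gamma>_def using N(1) by (simp add: reflection_scaleR)
    define g where "g = reflection \<gamma> \<circ> f"
    have gb: "g b = b" using reflection_swaps[of "f b" b] inner
      by (simp add: g_def refl_eq norm_eq)
    have g_fix: "g x = x" if "f x = x" for x
    proof -
      have "x \<bullet> (f b - b) = f x \<bullet> f b - x \<bullet> b" using that by (simp add: inner_diff_right)
      hence "x \<bullet> (f b - b) = 0" using inner by simp
      thus ?thesis using that by (simp add: g_def refl_eq reflection_fixes)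
    qed
    have "{x\<in>B. g x \<noteq> x} \<subset> {x\<in>B. f x \<noteq> x}" using g_fix gb b by auto
    hence less_card: "card {x\<in>B. g x \<noteq> x} < card {x\<in>B. f x \<noteq> x}"
      using B(1) by (intro psubset_card_mono) auto
    have "orthogonal_transformation g" unfolding g_def
      using reflection_orthogonal less.prems(1) by (rule orthogonal_transformation_compose)
    moreover have "g ` \<Gamma> \<subseteq> rational_hull \<Gamma>"
      using linear_image_rational_hull[OF reflection_linear refl[OF \<gamma>(1)]] less.prems(2)
      unfolding g_def image_comp[symmetric] by blast
    ultimately obtain \<gamma>s where \<gamma>s: "length \<gamma>s \<le> card {x\<in>B. g x \<noteq> x}" "set \<gamma>s \<subseteq> \<Gamma> - {0}"
        "g = foldr (\<circ>) (map reflection \<gamma>s) id"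
      using less.hyps[OF less_card] by blast
    have "f = reflection \<gamma> \<circ> g" unfolding g_def fun_eq_iff by (simp add: reflection_involution)
    hence "f = foldr (\<circ>) (map reflection (\<gamma> # \<gamma>s)) id" using \<gamma>s(3) by simp
    moreover have "length (\<gamma> # \<gamma>s) \<le> card {x\<in>B. f x \<noteq> x}" using \<gamma>s(1) less_card by simp
    ultimately show ?thesis using \<gamma>s(2) \<gamma> by (intro exI[of _ "\<gamma> # \<gamma>s"]) auto
  qed
qed

theorem corollary3p5:
  fixes S K :: "real set" and \<Gamma> :: "(real ^ 'n) set"
  assumes "real_subring S"
    and "fin_gen_Z_module S"
    and "K = fraction_field_in_real S"
    and "S_module_over S K \<Gamma>"
  shows "(\<forall>\<gamma>\<in>\<Gamma>. \<gamma> \<noteq> 0 \<longrightarrow> reflection \<gamma> \<in> OC \<Gamma>) \<and>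
    (\<forall>f\<in>OC \<Gamma>. \<exists>\<gamma>s. length \<gamma>s \<le> CARD('n) \<and> set \<gamma>s \<subseteq> \<Gamma> - {0} \<and>
       f = foldr (\<circ>) (map reflection \<gamma>s) id)"
proof -
  obtain B where B: "independent B" "span B = UNIV" "\<Gamma> = span_over S B"
    using assms(4) unfolding S_module_over_def by blast
  have finB: "finite B" and cardB: "card B \<le> CARD('n)"
    using independent_bound[OF B(1)] by auto
  have BG: "B \<subseteq> \<Gamma>" unfolding B(3) using assms(1) real_subring_add_subgroup[OF assms(1)] finB
    by (intro span_over_superset) (auto simp: real_subring_def add_subgroup_def)
  have G: "add_subgroup \<Gamma>" unfolding B(3) by (rule span_over_add_subgroup[OF assms(1)])
  have SG: "s *\<^sub>R v \<in> \<Gamma>" if "s \<in> S" "v \<in> \<Gamma>" for s v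
    using span_over_scaleR[OF assms(1)] that unfolding B(3) by blast
  have norms: "v \<bullet> v \<in> rational_hull S" if "v \<in> \<Gamma>" for v
    using that assms(3,4) fraction_field_subset_rational_hull[OF assms(1,2)]
    unfolding S_module_over_def by blast
  have refl: "reflection \<gamma> ` \<Gamma> \<subseteq> rational_hull \<Gamma>" if "\<gamma> \<in> \<Gamma>" for \<gamma>
    using reflection_in_rational_hull[OF assms(1,2) G SG norms that] by blast
  obtain C where C: "finite C" "C \<subseteq> S" "\<And>x. x \<in> S \<Longrightarrow> \<exists>c. x = (\<Sum>a\<in>C. of_int (c a) *\<^sub>R a)"
    using fin_gen_Z_moduleE[OF assms(2)] by blast
  have gens_in: "(case i of (b, a) \<Rightarrow> a *\<^sub>R b) \<in> \<Gamma>" if "i \<in> B \<times> C" for i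
    using that SG BG C(2) by auto
  have gen: "\<exists>c. v = (\<Sum>i\<in>B \<times> C. of_int (c i) *\<^sub>R (case i of (b, a) \<Rightarrow> a *\<^sub>R b))" if "v \<in> \<Gamma>" for v
    using span_over_generators[OF C(3), where v = v and B = B] that unfolding B(3) by (simp add: case_prod_unfold)
  have "reflection \<gamma> \<in> OC \<Gamma>" if "\<gamma> \<in> \<Gamma>" for \<gamma>
    using finite_cartesian_product[OF finB C(1)] gens_in gen G reflection_orthogonal
      reflection_involution refl[OF that]
    by (rule rational_involution_in_OC)
  moreover have "\<exists>\<gamma>s. length \<gamma>s \<le> CARD('n) \<and> set \<gamma>s \<subseteq> \<Gamma> - {0} \<and>
      f = foldr (\<circ>) (map reflection \<gamma>s) id" if f: "f \<in> OC \<Gamma>" for f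
  proof -
    have "orthogonal_transformation f" using f by (simp add: OC_def)
    then obtain \<gamma>s where "length \<gamma>s \<le> card {b\<in>B. f b \<noteq> b}" "set \<gamma>s \<subseteq> \<Gamma> - {0}"
        "f = foldr (\<circ>) (map reflection \<gamma>s) id"
      using reflection_decomposition[OF G finB BG B(2) refl _ OC_imp_rational[OF G f]] by blast
    moreover have "card {b\<in>B. f b \<noteq> b} \<le> card B" using finB by (intro card_mono) auto
    ultimately show ?thesis using cardB by (intro exI[of _ \<gamma>s]) auto
  qed
  ultimately show ?thesis by blast
qed

end
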